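(* Let $P$ be a probability measure on $(\Omega,\mathcal{M})$, $\tau:\Omega\to[0,\infty]$ measurable, and $\gamma\ne0,-1$ with $0<E_P[\tau^\gamma]<\infty$. Define the probability measure $dQ_\gamma=\tau^\gamma dP/E_P[\tau^\gamma]$, and for $\beta\in\mathbb{R}$ and $I\subset\mathbb{R}$ define $\mathcal{U}^\gamma_\beta(P)=\{Q:R_\beta(Q\|P)\le R_\beta(Q_\gamma\|P)\}$ and $\mathcal{U}^\gamma_I(P)=\{Q:R_\alpha(Q\|P)\le R_\alpha(Q_\gamma\|P)\text{ for all }\alpha\in I\}$. Then $Q_\gamma\in\mathcal{U}^\gamma_I(P)\subset\mathcal{U}^\gamma_\beta(P)$ for any $\beta\in I$, and: (1) If $\gamma>0$, $$\sup_{Q\in\mathcal{U}^\gamma_{(1,\infty)}(P)}\log\int\tau dQ=\sup_{Q\in\mathcal{U}^\gamma_{1+\gamma^{-1}}(P)}\log\int\tau dQ=\log\int\tau dQ_\gamma=\inf_{c>1}\Big\{\frac1c\log\int\tau^cdP+\frac1{c-1}R_{c/(c-1)}(Q_\gamma\|P)\Big\},$$ with the infimum achieved at $c=\gamma+1$. (2) If $\gamma\in(-1,0)$, $\tau<\infty$ $P$-a.s., and $E_P[\tau^{\gamma+1}]<\infty$, then $$\inf_{Q\in\mathcal{U}^\gamma_{(-\infty,0)}(P)}\log\int\tau dQ=\inf_{Q\in\mathcal{U}^\gamma_{1+\gamma^{-1}}(P)}\log\int\tau dQ=\log\int\tau dQ_\gamma=\sup_{c<1,c\ne0}\Big\{\frac1c\log\int\tau^cdP-\frac1{1-c}R_{1/(1-c)}(P\|Q_\gamma)\Big\},$$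 with the supremum achieved at $c=\gamma+1$. (3) If $\gamma<-1$, $$\inf_{Q\in\mathcal{U}^\gamma_{(0,1)}(P)}\log\int\tau dQ=\inf_{Q\in\mathcal{U}^\gamma_{1+\gamma^{-1}}(P)}\log\int\tau dQ=\log\int\tau dQ_\gamma=\sup_{c<1,c\ne0}\Big\{\frac1c\log\int\tau^cdP-\frac1{1-c}R_{1/(1-c)}(P\|Q_\gamma)\Big\},$$ with the supremum achieved at $c=\gamma+1$.
   Context: Powers $\tau^c=\exp(c\log\tau)$ with continuous extensions of $\exp,\log$ to extended reals; conventions $-\infty+\infty=\infty$ in upper bounds and $\infty-\infty=-\infty$ in lower bounds. Sets of $Q$ range over probability measures on $(\Omega,\mathcal{M})$. Rényi divergence: let $\nu$ be a $\sigma$-finite positive measure with $dP=p\,d\nu$, $dQ=q\,d\nu$. For $\alpha\in(0,1)$, $R_\alpha(Q\|P)=\frac{1}{\alpha(\alpha-1)}\log\int_{p>0}q^\alpha p^{1-\alpha}\,d\nu$; for $\alpha>1$, the same formula if $Q\ll P$ and $R_\alpha(Q\|P)=+\infty$ if $Q\not\ll P$; for $\alpha<0$, $R_\alpha(Q\|P)=R_{1-\alpha}(P\|Q)$. *)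

theory Defs
  imports "HOL-Probability.Probability"
begin

definition epow :: "ennreal \<Rightarrow> real \<Rightarrow> ennreal" where
  "epow t c =
     (if c = 0 then 1
      else if t = 0 then (if c > 0 then 0 else \<infinity>)
      else if t = \<infinity> then (if c > 0 then \<infinity> else 0)
      else ennreal (enn2real t powr c))"

definition elog :: "ennreal \<Rightarrow> ereal" where
  "elog t = (if t = 0 then -\<infinity> else if t = \<infinity> then \<infinity> else ereal (ln (enn2real t)))"

text \<open>Addition with the lower-bound convention \<infinity> - \<infinity> = -\<infinity>
  (Isabelle's own ereal addition already has the upper-bound convention -\<infinity> + \<infinity> = \<infinity>).\<close>
definition ladd :: "ereal \<Rightarrow> ereal \<Rightarrow> ereal" where
  "ladd a b = (if (a = \<infinity> \<and> b = -\<infinity>) \<or> (a = -\<infinity> \<and> b = \<infinity>) then -\<infinity> else a + b)"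

definition probs :: "'a measure \<Rightarrow> 'a measure set" where
  "probs M = {Q. prob_space Q \<and> sets Q = sets M}"

definition sum_meas :: "'a measure \<Rightarrow> 'a measure \<Rightarrow> 'a measure" where
  "sum_meas P Q = measure_of (space P) (sets P) (\<lambda>A. emeasure P A + emeasure Q A)"

definition renyi_pos :: "real \<Rightarrow> 'a measure \<Rightarrow> 'a measure \<Rightarrow> ereal" where
  "renyi_pos \<alpha> Q P =
     (let \<nu> = sum_meas P Q; p = RN_deriv \<nu> P; q = RN_deriv \<nu> Q in
      if \<alpha> > 1 \<and> \<not> absolutely_continuous P Q then \<infinity>
      else ereal (1 / (\<alpha> * (\<alpha> - 1))) *
        elog (\<integral>\<^sup>+ x. indicator {x. p x > 0} x * epow (q x) \<alpha> * epow (p x) (1 - \<alpha>) \<partial>\<nu>))"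

text \<open>Renyi divergence for \<alpha> \<notin> {0,1}; R_\<alpha>(Q||P) = R_{1-\<alpha>}(P||Q) for \<alpha> < 0.
  (The orders 0 and 1 are not used; the value there is an arbitrary 0.)\<close>
definition renyi :: "real \<Rightarrow> 'a measure \<Rightarrow> 'a measure \<Rightarrow> ereal" where
  "renyi \<alpha> Q P =
     (if \<alpha> = 0 \<or> \<alpha> = 1 then 0
      else if \<alpha> < 0 then renyi_pos (1 - \<alpha>) P Q
      else renyi_pos \<alpha> Q P)"

definition Qgam :: "'a measure \<Rightarrow> ('a \<Rightarrow> ennreal) \<Rightarrow> real \<Rightarrow> 'a measure" where
  "Qgam P \<tau> \<gamma> = density P (\<lambda>x. epow (\<tau> x) \<gamma> / (\<integral>\<^sup>+ y. epow (\<tau> y) \<gamma> \<partial>P))"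

definition U_beta :: "'a measure \<Rightarrow> ('a \<Rightarrow> ennreal) \<Rightarrow> real \<Rightarrow> real \<Rightarrow> 'a measure set" where
  "U_beta P \<tau> \<gamma> \<beta> = {Q \<in> probs P. renyi \<beta> Q P \<le> renyi \<beta> (Qgam P \<tau> \<gamma>) P}"

definition U_set :: "'a measure \<Rightarrow> ('a \<Rightarrow> ennreal) \<Rightarrow> real \<Rightarrow> real set \<Rightarrow> 'a measure set" where
  "U_set P \<tau> \<gamma> I = {Q \<in> probs P. \<forall>\<alpha>\<in>I. renyi \<alpha> Q P \<le> renyi \<alpha> (Qgam P \<tau> \<gamma>) P}"

end

theory Submission
  imports Defs
begin

text \<open>
  Fix a common dominating measure of \<open>P\<close> and \<open>Q\<close>, with densities \<open>p\<close> and \<open>q\<close>. Hoelder's inequality,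
  applied to the factorisations
  \<^item> \<open>\<tau> q = (\<tau>\<^sup>c p)\<^bsup>1/c\<^esup> (q\<^sup>\<alpha> p\<^bsup>1-\<alpha>\<^esup>)\<^bsup>1-1/c\<^esup>\<close> for \<open>c > 1\<close>, \<open>\<alpha> = c/(c-1)\<close>,
  \<^item> \<open>\<tau>\<^sup>c p = (\<tau> q)\<^sup>c (p\<^sup>\<alpha> q\<^bsup>1-\<alpha>\<^esup>)\<^bsup>1-c\<^esup>\<close> for \<open>0 < c < 1\<close>, \<open>\<alpha> = 1/(1-c)\<close>,
  \<^item> \<open>p\<^sup>\<alpha> q\<^bsup>1-\<alpha>\<^esup> = (\<tau>\<^sup>c p)\<^sup>\<alpha> (\<tau> q)\<^bsup>1-\<alpha>\<^esup>\<close> for \<open>c < 0\<close>, \<open>\<alpha> = 1/(1-c)\<close>,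

  bounds \<open>log \<integral>\<tau> dQ\<close> above (first case) or below (other cases) by \<open>(1/c) log \<integral>\<tau>\<^sup>c dP\<close> plus or minus a
  multiple of a Renyi divergence, for every \<open>Q\<close>. The tilted measure \<open>Q\<^sub>\<gamma>\<close> is the equality case of Hoelder
  at \<open>c = \<gamma> + 1\<close>, so it is optimal over every ball of the divergence of order \<open>1 + 1/\<gamma>\<close>, and conversely
  \<open>c = \<gamma> + 1\<close> is optimal in the bound for \<open>Q\<^sub>\<gamma>\<close>.
\<close>

section \<open>Extended powers and logarithms\<close>

lemma ennreal_zero_pos_top_cases [case_names zero top pos]:
  fixes x :: ennreal
  obtains "x = 0" | "x = top" | r where "0 < r" "x = ennreal r"
proof (cases x)
  case (real r)
  then show ?thesis using that by (cases "r = 0") auto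
qed (use that in auto)

lemma epow_simps [simp]:
  "epow t 0 = 1"
  "c > 0 \<Longrightarrow> epow 0 c = 0"
  "c < 0 \<Longrightarrow> epow 0 c = top"
  "c > 0 \<Longrightarrow> epow top c = top"
  "c < 0 \<Longrightarrow> epow top c = 0"
  "r > 0 \<Longrightarrow> epow (ennreal r) c = ennreal (r powr c)"
  by (auto simp: epow_def)

lemma epow_one [simp]: "epow t 1 = t"
  by (cases t rule: ennreal_zero_pos_top_cases) auto

lemma elog_simps [simp]:
  "elog 0 = -\<infinity>" "elog top = \<infinity>" "r > 0 \<Longrightarrow> elog (ennreal r) = ereal (ln r)"
  by (auto simp: elog_def)

lemma epow_measurable [measurable]: "(\<lambda>t. epow t c) \<in> borel_measurable borel"
  unfolding epow_def by measurable

lemma epow_eq_0_iff: "c > 0 \<Longrightarrow> epow t c = 0 \<longleftrightarrow> t = 0"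
  by (cases t rule: ennreal_zero_pos_top_cases) auto

text \<open>The bounds on \<open>k\<close> avoid \<open>0 * top\<close>: at \<open>t = top\<close>,
  \<open>k = 0\<close>, \<open>c < 0\<close> the left side is \<open>top\<close> and the right side
  \<open>0\<close>.\<close>

lemma epow_mult:
  assumes "0 < k" "k < top"
  shows "epow (t * k) c = epow t c * epow k c"
proof -
  obtain r where r: "r > 0" "k = ennreal r"
    using assms by (cases k rule: ennreal_zero_pos_top_cases) auto
  consider "c < 0" | "c = 0" | "c > 0" by linarith
  then show ?thesis
    using r by cases (cases t rule: ennreal_zero_pos_top_cases;
      simp add: ennreal_mult[symmetric] powr_mult ennreal_top_mult)+
qed

lemma epow_add:
  assumes "0 < t" "t < top"
  shows "epow t a * epow t b = epow t (a + b)"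
  using assms by (cases t rule: ennreal_zero_pos_top_cases) (auto simp: ennreal_mult[symmetric] powr_add)

lemma epow_epow: "epow (epow t a) b = epow t (a * b)"
proof -
  have "a < 0 \<or> a = 0 \<or> a > 0" "b < 0 \<or> b = 0 \<or> b > 0" by linarith+
  moreover have "epow 1 b = 1"
    using epow_simps(6)[of 1 b] by simp
  ultimately show ?thesis
    by (cases t rule: ennreal_zero_pos_top_cases; elim disjE;
        simp add: powr_powr mult_neg_neg mult_pos_neg mult_neg_pos)
qed

text \<open>From \<open>1\<close> on the left power is at most \<open>1\<close>, and below
  \<open>1\<close> a smaller exponent gives a larger power. This makes \<open>W\<close> finite when
  \<open>\<gamma> < -1\<close>.\<close>

lemma epow_succ_le:
  assumes "c < -1"
  shows "epow t (c + 1) \<le> 1 + epow t c"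
proof (cases t rule: ennreal_zero_pos_top_cases)
  case (pos r)
  have "r powr (c + 1) \<le> 1 + r powr c"
  proof (cases "r \<ge> 1")
    case True
    then have "r powr (c + 1) \<le> r powr 0" using assms by (intro powr_mono) auto
    then show ?thesis using pos by (simp add: add_increasing2)
  next
    case False
    then have "r powr (c + 1) \<le> r powr c" using pos by (intro powr_mono') auto
    then show ?thesis by simp
  qed
  then have "ennreal (r powr (c + 1)) \<le> ennreal (1 + r powr c)" by (rule ennreal_leI)
  then show ?thesis using pos by simp
qed (use assms in auto)

section \<open>Hoelder's inequality for extended nonnegative functions\<close>

lemma epow_weighted_AM_GM:
  assumes s: "0 < s" "s < 1"
  shows "epow a s * epow b (1 - s) \<le> ennreal s * a + ennreal (1 - s) * b"
proof (cases a rule: ennreal_zero_pos_top_cases; cases b rule: ennreal_zero_pos_top_cases)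
  fix x y assume xy: "0 < x" "a = ennreal x" "0 < y" "b = ennreal y"
  have "x powr s * y powr (1 - s) \<le> s * x + (1 - s) * y"
    using Youngs_inequality_0[of s "1 - s" x y] s xy by simp
  then show ?thesis
    using xy s by (simp add: ennreal_mult[symmetric] ennreal_plus[symmetric] ennreal_leI del: ennreal_plus)
qed (use s in \<open>auto simp: ennreal_mult_top ennreal_top_mult\<close>)

text \<open>Dividing \<open>f\<close> and \<open>g\<close> by their integrals reduces the claim to
  pointwise weighted AM-GM, whose right side then integrates to \<open>s + (1 - s) = 1\<close>. If
  an integral vanishes, so does the integrand almost everywhere; if neither does and one is
  infinite, the right side is infinite.\<close>

lemma nn_integral_Holder:
  assumes [measurable]: "f \<in> borel_measurable M" "g \<in> borel_measurable M"
    and s: "0 < s" "s < 1"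
  shows "(\<integral>\<^sup>+x. epow (f x) s * epow (g x) (1 - s) \<partial>M)
    \<le> epow (\<integral>\<^sup>+x. f x \<partial>M) s * epow (\<integral>\<^sup>+x. g x \<partial>M) (1 - s)"
proof -
  let ?A = "\<integral>\<^sup>+x. f x \<partial>M" and ?B = "\<integral>\<^sup>+x. g x \<partial>M"
  have zero: "(\<integral>\<^sup>+x. epow (f x) s * epow (g x) (1 - s) \<partial>M) = 0" if "?A = 0 \<or> ?B = 0"
  proof -
    have "(AE x in M. f x = 0) \<or> (AE x in M. g x = 0)"
      using that by (simp add: nn_integral_0_iff_AE)
    then have "AE x in M. epow (f x) s * epow (g x) (1 - s) = 0"
      using s by (auto elim!: eventually_mono)
    then show ?thesis by (simp add: nn_integral_0_iff_AE)
  qed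
  show ?thesis
  proof (cases ?A rule: ennreal_zero_pos_top_cases; cases ?B rule: ennreal_zero_pos_top_cases)
    fix a b assume ab: "0 < a" "?A = ennreal a" "0 < b" "?B = ennreal b"
    define k where "k = ennreal (a powr s * b powr (1 - s))"
    have "epow (f x) s * epow (g x) (1 - s)
        \<le> k * (ennreal s * (f x * ennreal (1/a)) + ennreal (1 - s) * (g x * ennreal (1/b)))" for x
    proof -
      have "epow (f x) s * epow (g x) (1 - s)
          = k * (epow (f x * ennreal (1/a)) s * epow (g x * ennreal (1/b)) (1 - s))"
      proof -
        have "k * (epow (f x * ennreal (1/a)) s * epow (g x * ennreal (1/b)) (1 - s))
          = (k * ennreal ((1/a) powr s * (1/b) powr (1 - s))) * (epow (f x) s * epow (g x) (1 - s))"
          using ab by (simp add: epow_mult ennreal_mult mult_ac)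
        also have "k * ennreal ((1/a) powr s * (1/b) powr (1 - s)) = 1"
          using ab by (simp add: k_def ennreal_mult[symmetric] powr_divide)
        finally show ?thesis by simp
      qed
      also have "\<dots> \<le> k * (ennreal s * (f x * ennreal (1/a)) + ennreal (1 - s) * (g x * ennreal (1/b)))"
        by (intro mult_left_mono epow_weighted_AM_GM s) auto
      finally show ?thesis .
    qed
    then have "(\<integral>\<^sup>+x. epow (f x) s * epow (g x) (1 - s) \<partial>M)
      \<le> (\<integral>\<^sup>+x. k * (ennreal s * (f x * ennreal (1/a)) + ennreal (1 - s) * (g x * ennreal (1/b))) \<partial>M)"
      by (intro nn_integral_mono)
    also have "\<dots> = k * (ennreal s * (?A * ennreal (1/a)) + ennreal (1 - s) * (?B * ennreal (1/b)))"
      by (simp add: nn_integral_cmult nn_integral_add nn_integral_multc)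
    also have "\<dots> = k"
      using ab s by (simp add: ennreal_mult[symmetric] ennreal_plus[symmetric] del: ennreal_plus)
    also have "\<dots> = epow ?A s * epow ?B (1 - s)"
      using ab by (simp add: k_def ennreal_mult)
    finally show ?thesis .
  qed (use s zero in \<open>auto simp: ennreal_top_mult ennreal_mult_top\<close>)
qed

lemma elog_mono: "a \<le> b \<Longrightarrow> elog a \<le> elog b"
  by (cases a rule: ennreal_zero_pos_top_cases; cases b rule: ennreal_zero_pos_top_cases)
    (auto simp: top_unique)

text \<open>If one of \<open>a\<close>, \<open>b\<close> is \<open>0\<close> and the other
  \<open>top\<close>, the product is \<open>0\<close> while the sum of logarithms is
  \<open>\<infinity>\<close>: the convention of \<open>ereal\<close> addition suits upper
  bounds.\<close>

lemma elog_le_weighted_sum: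
  assumes "x \<le> epow a s * epow b (1 - s)" "0 < s" "s < 1"
  shows "elog x \<le> ereal s * elog a + ereal (1 - s) * elog b"
proof -
  have "elog (epow a s * epow b (1 - s)) \<le> ereal s * elog a + ereal (1 - s) * elog b"
    using assms(2,3)
    by (cases a rule: ennreal_zero_pos_top_cases; cases b rule: ennreal_zero_pos_top_cases)
      (auto simp: ennreal_top_mult ennreal_mult_top ennreal_mult[symmetric] ln_mult ln_powr)
  with elog_mono[OF assms(1)] show ?thesis by (rule order_trans)
qed

section \<open>Pointwise Hoelder factorisations\<close>

lemma powr_eq_exp: "(0::real) < x \<Longrightarrow> x powr a = exp (a * ln x)"
  by (simp add: powr_def)

text \<open>For positive finite values both sides agree. Where \<open>p = 0\<close> the indicator
  kills the right side, and \<open>ac\<close> makes the left side vanish too.\<close>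

lemma epow_Holder_split_gt_1:
  assumes c: "c > 1" and q: "q < top" and p: "p < top" and ac: "p = 0 \<Longrightarrow> q = 0"
  shows "t * q \<le> epow (epow t c * p) (1 / c)
    * epow (indicator {0<..} p * epow q (c / (c - 1)) * epow p (1 - c / (c - 1))) (1 - 1 / c)"
proof (cases "t = 0 \<or> q = 0")
  case False
  then obtain p' q' where pq: "0 < p'" "p = ennreal p'" "0 < q'" "q = ennreal q'"
    using p q ac by (cases p rule: ennreal_zero_pos_top_cases; cases q rule: ennreal_zero_pos_top_cases) auto
  show ?thesis
  proof (cases t rule: ennreal_zero_pos_top_cases)
    case top
    then show ?thesis using c pq by (simp add: ennreal_top_mult ennreal_mult[symmetric])
  next
    case (pos r)
    have e: "(c * ln r + ln p') / c + (c / (c - 1) * ln q' + (1 - c / (c - 1)) * ln p') * (1 - 1 / c)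
        = ln r + ln q'"
    proof -
      \<comment> \<open>Naming the reciprocals makes the identity polynomial modulo
        \<open>(c - 1) * a = 1\<close> and \<open>c * d = 1\<close>.\<close>
      define a d where "a = 1 / (c - 1)" and "d = 1 / c"
      then have "(c - 1) * a = 1" "c * d = 1" using c by auto
      then have "(c * ln r + ln p') * d + (c * a * ln q' + (1 - c * a) * ln p') * (1 - d) = ln r + ln q'"
        by algebra
      then show ?thesis by (simp add: a_def d_def)
    qed
    have "(r powr c * p') powr (1 / c)
       * (q' powr (c / (c - 1)) * p' powr (1 - c / (c - 1))) powr (1 - 1 / c) = exp (ln r + ln q')"
      unfolding e[symmetric] using pos pq
      by (simp add: powr_eq_exp ln_mult exp_add)
    also have "\<dots> = r * q'" using pos pq by (simp add: exp_add)
    finally show ?thesis using pos pq by (simp add: ennreal_mult[symmetric])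
  qed (use False in auto)
qed auto

text \<open>Compared with \<open>c > 1\<close> the domination hypothesis is reversed, since now the
  integrand against \<open>P\<close> is the one bounded.\<close>

lemma epow_Holder_split_between_0_1:
  assumes c: "0 < c" "c < 1" and q: "q < top" and p: "p < top" and ac: "q = 0 \<Longrightarrow> p = 0"
  shows "epow t c * p \<le> epow (t * q) c
    * epow (indicator {0<..} q * epow p (1 / (1 - c)) * epow q (1 - 1 / (1 - c))) (1 - c)"
proof (cases "t = 0 \<or> p = 0")
  case False
  then obtain p' q' where pq: "0 < p'" "p = ennreal p'" "0 < q'" "q = ennreal q'"
    using p q ac by (cases p rule: ennreal_zero_pos_top_cases; cases q rule: ennreal_zero_pos_top_cases) auto
  show ?thesis
  proof (cases t rule: ennreal_zero_pos_top_cases)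
    case top
    then show ?thesis using c pq by (simp add: ennreal_top_mult ennreal_mult[symmetric])
  next
    case (pos r)
    have e: "c * (ln r + ln q') + (1 - c) * ((1 / (1 - c)) * ln p' + (1 - 1 / (1 - c)) * ln q')
        = c * ln r + ln p'"
    proof -
      define a where "a = 1 / (1 - c)"
      then have "(1 - c) * a = 1" using c by auto
      then show ?thesis unfolding a_def[symmetric] by algebra
    qed
    have "(r * q') powr c
       * (p' powr (1 / (1 - c)) * q' powr (1 - 1 / (1 - c))) powr (1 - c) = exp (c * ln r + ln p')"
      unfolding e[symmetric] using pos pq
      by (simp add: powr_eq_exp ln_mult exp_add)
    also have "\<dots> = r powr c * p'" using pos pq by (simp add: exp_add powr_eq_exp)
    finally show ?thesis using pos pq by (simp add: ennreal_mult[symmetric])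
  qed (use False in auto)
qed (use c in auto)

text \<open>For positive \<open>p\<close> and \<open>q\<close>, a value \<open>0\<close> or
  \<open>top\<close> of \<open>t\<close> would make the right side \<open>top * 0\<close> or
  \<open>0 * top\<close>, hence \<open>0\<close>; the hypotheses on \<open>t\<close> exclude
  this.\<close>

lemma epow_Holder_split_neg:
  assumes c: "c < 0" and q: "q < top" and p: "p < top"
    and t: "t = 0 \<Longrightarrow> p = 0" "t = top \<Longrightarrow> q = 0"
  shows "indicator {0<..} q * epow p (1 / (1 - c)) * epow q (1 - 1 / (1 - c))
    \<le> epow (epow t c * p) (1 / (1 - c)) * epow (t * q) (1 - 1 / (1 - c))"
proof (cases "p = 0 \<or> q = 0")
  case False
  then obtain p' q' r where pq: "0 < p'" "p = ennreal p'" "0 < q'" "q = ennreal q'" "r > 0" "t = ennreal r"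
    using p q t by (cases p rule: ennreal_zero_pos_top_cases; cases q rule: ennreal_zero_pos_top_cases;
        cases t rule: ennreal_zero_pos_top_cases) auto
  have e: "(1 / (1 - c)) * (c * ln r + ln p') + (1 - 1 / (1 - c)) * (ln r + ln q')
     = (1 / (1 - c)) * ln p' + (1 - 1 / (1 - c)) * ln q'"
    using c by (simp add: field_simps)
  have "(r powr c * p') powr (1 / (1 - c)) * (r * q') powr (1 - 1 / (1 - c))
     = exp ((1 / (1 - c)) * ln p' + (1 - 1 / (1 - c)) * ln q')"
    unfolding e[symmetric] using pq by (simp add: powr_eq_exp ln_mult exp_add)
  also have "\<dots> = p' powr (1 / (1 - c)) * q' powr (1 - 1 / (1 - c))"
    using pq by (simp add: exp_add powr_eq_exp)
  finally show ?thesis using pq by (simp add: ennreal_mult[symmetric])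
qed (use c in auto)

section \<open>Rearranging logarithmic bounds under the lower-bound convention\<close>

lemma ladd_mono_right: "b \<le> b' \<Longrightarrow> ladd a b \<le> ladd a b'"
  by (cases a; cases b; cases b') (auto simp: ladd_def)

text \<open>Solves the logarithmic Hoelder inequality for \<open>a\<close>. For
  \<open>x = b = -\<infinity>\<close> the hypothesis says nothing about \<open>a\<close>, and the
  convention of \<open>ladd\<close> keeps the left side at -\<infinity>.\<close>

lemma ladd_le_of_le_pos:
  assumes c: "0 < c" "c < 1" and le: "x \<le> ereal c * a + ereal (1 - c) * b"
  shows "ladd (ereal (1 / c) * x) (- (ereal ((1 - c) / c) * b)) \<le> a"
proof (cases "\<bar>x\<bar> \<noteq> \<infinity> \<and> \<bar>a\<bar> \<noteq> \<infinity> \<and> \<bar>b\<bar> \<noteq> \<infinity>")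
  case True
  then obtain x' a' b' where [simp]: "x = ereal x'" "a = ereal a'" "b = ereal b'" by auto
  have "x' - (1 - c) * b' \<le> c * a'" using le by simp
  then have "(x' - (1 - c) * b') / c \<le> a'" using c by (simp add: pos_divide_le_eq mult.commute)
  then show ?thesis using c by (simp add: ladd_def diff_divide_distrib left_diff_distrib)
next
  case False
  then show ?thesis using c le
    by (cases x; cases a; cases b) (auto simp: ladd_def)
qed

text \<open>Division by the negative \<open>c\<close> reverses the inequality, so an upper bound on
  the Hellinger term \<open>b\<close> becomes a lower bound on \<open>a\<close>.\<close>

lemma ladd_le_of_le_neg:
  assumes c: "c < 0" and le: "b \<le> ereal (1 / (1 - c)) * x + ereal (1 - 1 / (1 - c)) * a"
    and fin: "x \<noteq> \<infinity>" "a \<noteq> \<infinity>"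
  shows "ladd (ereal (1 / c) * x) (- (ereal ((1 - c) / c) * b)) \<le> a"
proof (cases "\<bar>x\<bar> \<noteq> \<infinity> \<and> \<bar>a\<bar> \<noteq> \<infinity> \<and> \<bar>b\<bar> \<noteq> \<infinity>")
  case True
  then obtain x' a' b' where [simp]: "x = ereal x'" "a = ereal a'" "b = ereal b'" by auto
  have "1 - 1 / (1 - c) = - c / (1 - c)" using c by (simp add: field_simps)
  then have "b' \<le> (x' - c * a') / (1 - c)" using le by (simp add: diff_divide_distrib)
  then have "c * a' \<le> x' - (1 - c) * b'" using c by (simp add: pos_le_divide_eq mult.commute)
  then have "(x' - (1 - c) * b') / c \<le> a'" using c by (simp add: neg_divide_le_eq mult.commute)
  then show ?thesis using c by (simp add: ladd_def diff_divide_distrib left_diff_distrib)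
next
  case False
  then show ?thesis using c le fin
    by (cases x; cases a; cases b) (auto simp: ladd_def divide_less_0_iff zero_less_divide_iff)
qed

lemma elog_eq_PInf_iff [simp]: "elog t = \<infinity> \<longleftrightarrow> t = top"
  by (auto simp: elog_def)

section \<open>Renyi bounds for arbitrary pairs\<close>

lemma
  assumes "finite_measure P" "finite_measure Q" "sets Q = sets P"
  shows sets_sum_meas [simp]: "sets (sum_meas P Q) = sets P"
    and emeasure_sum_meas:
      "A \<in> sets P \<Longrightarrow> emeasure (sum_meas P Q) A = emeasure P A + emeasure Q A"
    and finite_measure_sum_meas: "finite_measure (sum_meas P Q)"
proof -
  show sets: "sets (sum_meas P Q) = sets P"
    by (simp add: sum_meas_def sets.sets_measure_of_eq)
  have sp: "space (sum_meas P Q) = space P"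
    using sets by (rule sets_eq_imp_space_eq)
  show em: "emeasure (sum_meas P Q) A = emeasure P A + emeasure Q A" if "A \<in> sets P" for A
    unfolding sum_meas_def
  proof (rule emeasure_measure_of_sigma)
    show "sigma_algebra (space P) (sets P)" ..
    show "positive (sets P) (\<lambda>A. emeasure P A + emeasure Q A)"
      by (simp add: positive_def)
    show "countably_additive (sets P) (\<lambda>A. emeasure P A + emeasure Q A)"
      using assms(3) by (auto simp: countably_additive_def suminf_add[symmetric] suminf_emeasure)
  qed fact
  show "finite_measure (sum_meas P Q)"
  proof
    show "emeasure (sum_meas P Q) (space (sum_meas P Q)) \<noteq> \<infinity>"
      using finite_measure.emeasure_finite[OF assms(1), of "space P"]
        finite_measure.emeasure_finite[OF assms(2), of "space P"]
      by (subst sp, subst em) (auto intro: sets.top)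
  qed
qed

text \<open>Isolates the integral inside \<open>renyi_pos\<close>, so that Hoelder bounds come
  before any logarithm. The indicator acts on the density value, to match the pointwise
  factorisations.\<close>

definition hellinger_integral :: "real \<Rightarrow> 'a measure \<Rightarrow> 'a measure \<Rightarrow> ennreal" where
  "hellinger_integral \<alpha> Q P =
    (\<integral>\<^sup>+ x. indicator {0<..} (RN_deriv (sum_meas P Q) P x) * epow (RN_deriv (sum_meas P Q) Q x) \<alpha>
      * epow (RN_deriv (sum_meas P Q) P x) (1 - \<alpha>) \<partial>sum_meas P Q)"

lemma renyi_pos_eq_hellinger_integral:
  "renyi_pos \<alpha> Q P = (if \<alpha> > 1 \<and> \<not> absolutely_continuous P Q then \<infinity>
     else ereal (1 / (\<alpha> * (\<alpha> - 1))) * elog (hellinger_integral \<alpha> Q P))"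
proof -
  have "indicator {x. 0 < f x} x = (indicator {0<..} (f x) :: ennreal)" for f :: "'a \<Rightarrow> ennreal" and x
    by (simp add: indicator_def)
  then show ?thesis by (simp add: renyi_pos_def hellinger_integral_def Let_def)
qed

section \<open>Densities with respect to the sum measure\<close>

locale prob_pair =
  fixes P Q :: "'a measure"
  assumes prob_P: "prob_space P" and prob_Q: "prob_space Q" and sets_eq: "sets Q = sets P"
begin

abbreviation "\<nu> \<equiv> sum_meas P Q"
abbreviation "p \<equiv> RN_deriv \<nu> P"
abbreviation "q \<equiv> RN_deriv \<nu> Q"

sublocale P: prob_space P by (rule prob_P)
sublocale Q: prob_space Q by (rule prob_Q)

lemmas sum_facts = P.finite_measure_axioms Q.finite_measure_axioms sets_eq

sublocale nu: finite_measure \<nu> by (rule finite_measure_sum_meas[OF sum_facts])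

lemma sets_nu [measurable_cong, simp]: "sets \<nu> = sets P"
  by (rule sets_sum_meas[OF sum_facts])

lemma ac_P: "absolutely_continuous \<nu> P" and ac_Q: "absolutely_continuous \<nu> Q"
  using sets_eq by (auto simp: absolutely_continuous_def null_sets_def emeasure_sum_meas[OF sum_facts])

lemma density_p: "density \<nu> p = P" and density_q: "density \<nu> q = Q"
  using nu.density_RN_deriv[OF ac_P] nu.density_RN_deriv[OF ac_Q] sets_eq by auto

lemma p_finite: "AE x in \<nu>. p x < top" and q_finite: "AE x in \<nu>. q x < top"
  using nu.RN_deriv_finite[OF P.sigma_finite_measure_axioms ac_P]
    nu.RN_deriv_finite[OF Q.sigma_finite_measure_axioms ac_Q] sets_eq
  by (auto simp: less_top)

lemma nn_integral_P:
  "f \<in> borel_measurable P \<Longrightarrow> (\<integral>\<^sup>+x. f x \<partial>P) = (\<integral>\<^sup>+x. f x * p x \<partial>\<nu>)"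
  using nu.RN_deriv_nn_integral[OF ac_P] by (simp add: mult.commute cong: measurable_cong_sets)

lemma nn_integral_Q:
  "f \<in> borel_measurable P \<Longrightarrow> (\<integral>\<^sup>+x. f x \<partial>Q) = (\<integral>\<^sup>+x. f x * q x \<partial>\<nu>)"
  using nu.RN_deriv_nn_integral[OF ac_Q] sets_eq by (simp add: mult.commute cong: measurable_cong_sets)

lemma AE_P_iff: "Measurable.pred P R \<Longrightarrow> (AE x in P. R x) \<longleftrightarrow> (AE x in \<nu>. 0 < p x \<longrightarrow> R x)"
  using AE_density[of p \<nu> R] by (simp only: density_p) simp

lemma AE_Q_iff: "(AE x in Q. R x) \<longleftrightarrow> (AE x in \<nu>. 0 < q x \<longrightarrow> R x)"
  using AE_density[of q \<nu> R] by (simp only: density_q) simp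

text \<open>\<open>p\<close> is nonzero almost everywhere for \<open>P\<close>, hence by domination
  for \<open>Q\<close>; read with respect to \<open>\<nu>\<close>, this is the claim.\<close>

lemma absolutely_continuous_imp_AE_density_0:
  assumes "absolutely_continuous P Q"
  shows "AE x in \<nu>. p x = 0 \<longrightarrow> q x = 0"
proof -
  have "AE x in density \<nu> p. p x \<noteq> 0" by (subst AE_density) auto
  then have "AE x in P. p x \<noteq> 0" by (simp only: density_p)
  then have "AE x in Q. p x \<noteq> 0" by (rule absolutely_continuous_AE[OF sets_eq assms])
  then show ?thesis by (auto simp: AE_Q_iff elim!: eventually_mono)
qed

lemma swap: "prob_pair Q P"
  using prob_P prob_Q sets_eq by (simp add: prob_pair_def)

lemma sum_meas_commute: "sum_meas Q P = \<nu>"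
  using sets_eq sets_eq_imp_space_eq[OF sets_eq] by (simp add: sum_meas_def add.commute)

lemma hellinger_integral_PQ:
  "hellinger_integral \<alpha> P Q = (\<integral>\<^sup>+ x. indicator {0<..} (q x) * epow (p x) \<alpha> * epow (q x) (1 - \<alpha>) \<partial>\<nu>)"
  by (simp add: hellinger_integral_def sum_meas_commute)

text \<open>Both exponents are positive, so the integrand vanishes where either density does and the
  indicator may sit on either one.\<close>

lemma hellinger_integral_swap:
  assumes "0 < \<alpha>" "\<alpha> < 1"
  shows "hellinger_integral \<alpha> Q P = hellinger_integral (1 - \<alpha>) P Q"
proof -
  have "indicator {0<..} a * epow b \<alpha> * epow a (1 - \<alpha>) = indicator {0<..} b * epow a (1 - \<alpha>) * epow b \<alpha>"
    for a b :: ennreal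
    using assms by (auto simp: indicator_def mult.commute not_less)
  then show ?thesis
    by (simp add: hellinger_integral_def sum_meas_commute)
qed

text \<open>Outside [0, 1] this is how negative orders are defined, and at \<open>0\<close> and
  \<open>1\<close> both sides are the default \<open>0\<close>. Orders in between use the symmetry
  of the Hellinger integral.\<close>

lemma renyi_skew_symmetry: "renyi (1 - \<alpha>) P Q = renyi \<alpha> Q P"
proof (cases "0 < \<alpha> \<and> \<alpha> < 1")
  case True
  then have "renyi (1 - \<alpha>) P Q = renyi_pos (1 - \<alpha>) P Q" "renyi \<alpha> Q P = renyi_pos \<alpha> Q P"
    by (auto simp: renyi_def)
  moreover have "1 / ((1 - \<alpha>) * (1 - \<alpha> - 1)) = 1 / (\<alpha> * (\<alpha> - 1))"
    by (rule arg_cong[where f = "\<lambda>x. 1 / x"]) algebra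
  ultimately show ?thesis
    using True by (simp only: renyi_pos_eq_hellinger_integral hellinger_integral_swap) auto
qed (auto simp: renyi_def)

section \<open>Bounds on the integral of \<tau> for an arbitrary second measure\<close>

lemma elog_integral_le_renyi:
  assumes c: "c > 1" and [measurable]: "\<tau> \<in> borel_measurable P"
  shows "elog (\<integral>\<^sup>+x. \<tau> x \<partial>Q) \<le> ereal (1 / c) * elog (\<integral>\<^sup>+x. epow (\<tau> x) c \<partial>P)
    + ereal (1 / (c - 1)) * renyi (c / (c - 1)) Q P"
proof -
  let ?\<alpha> = "c / (c - 1)"
  have \<alpha>: "?\<alpha> > 1" using c by (simp add: field_simps)
  have ren: "renyi ?\<alpha> Q P = renyi_pos ?\<alpha> Q P" using c by (simp add: renyi_def divide_less_0_iff)
  show ?thesis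
  proof (cases "absolutely_continuous P Q")
    case True
    let ?h = "\<lambda>x. indicator {0<..} (p x) * epow (q x) ?\<alpha> * epow (p x) (1 - ?\<alpha>)"
    have "(\<integral>\<^sup>+x. \<tau> x \<partial>Q) = (\<integral>\<^sup>+x. \<tau> x * q x \<partial>\<nu>)"
      by (rule nn_integral_Q) simp
    also have "\<dots> \<le> (\<integral>\<^sup>+x. epow (epow (\<tau> x) c * p x) (1 / c) * epow (?h x) (1 - 1 / c) \<partial>\<nu>)"
      using absolutely_continuous_imp_AE_density_0[OF True] p_finite q_finite
      by (intro nn_integral_mono_AE, eventually_elim) (rule epow_Holder_split_gt_1[OF c], auto)
    also have "\<dots> \<le> epow (\<integral>\<^sup>+x. epow (\<tau> x) c * p x \<partial>\<nu>) (1 / c) * epow (\<integral>\<^sup>+x. ?h x \<partial>\<nu>) (1 - 1 / c)"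
      using c by (intro nn_integral_Holder) auto
    also have "\<dots> = epow (\<integral>\<^sup>+x. epow (\<tau> x) c \<partial>P) (1 / c) * epow (hellinger_integral ?\<alpha> Q P) (1 - 1 / c)"
      by (simp add: nn_integral_P hellinger_integral_def)
    finally have "elog (\<integral>\<^sup>+x. \<tau> x \<partial>Q) \<le> ereal (1 / c) * elog (\<integral>\<^sup>+x. epow (\<tau> x) c \<partial>P)
      + ereal (1 - 1 / c) * elog (hellinger_integral ?\<alpha> Q P)"
      using c by (intro elog_le_weighted_sum) auto
    \<comment> \<open>For this order \<open>1 / (?\<alpha> * (?\<alpha> - 1))\<close> equals
      \<open>(c - 1)^2 / c\<close>; division by \<open>c - 1\<close> leaves the Hoelder weight
      \<open>1 - 1 / c\<close>.\<close>
    also have "ereal (1 - 1 / c) * elog (hellinger_integral ?\<alpha> Q P) = ereal (1 / (c - 1)) * renyi ?\<alpha> Q P"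
    proof -
      have "?\<alpha> - 1 = 1 / (c - 1)" "1 - 1 / c = (c - 1) / c" using c by (auto simp: field_simps)
      then have "1 - 1 / c = 1 / (c - 1) * (1 / (?\<alpha> * (?\<alpha> - 1)))"
        using c by simp
      then show ?thesis
        using True by (simp only: ren renyi_pos_eq_hellinger_integral times_ereal.simps(1)[symmetric] mult.assoc) simp
    qed
    finally show ?thesis .
  next
    case False
    \<comment> \<open>The divergence is infinite, and so is the right side, even if the other
      summand is -\<infinity>.\<close>
    then show ?thesis using \<alpha> c by (simp add: ren renyi_pos_eq_hellinger_integral)
  qed
qed

text \<open>For \<open>0 < c < 1\<close> the order exceeds \<open>1\<close> and Hoelder bounds the
  integral of the power of \<open>\<tau>\<close> against \<open>P\<close>. For \<open>c < 0\<close>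
  the order lies between \<open>0\<close> and \<open>1\<close> and Hoelder bounds the Hellinger
  integral instead.\<close>

lemma renyi_le_elog_integral:
  assumes c: "c < 1" "c \<noteq> 0" and [measurable]: "\<tau> \<in> borel_measurable P"
  shows "ladd (ereal (1 / c) * elog (\<integral>\<^sup>+x. epow (\<tau> x) c \<partial>P))
    (- (ereal (1 / (1 - c)) * renyi (1 / (1 - c)) P Q)) \<le> elog (\<integral>\<^sup>+x. \<tau> x \<partial>Q)"
    (is "ladd ?X ?R \<le> _")
proof -
  let ?\<alpha> = "1 / (1 - c)"
  let ?h = "\<lambda>x. indicator {0<..} (q x) * epow (p x) ?\<alpha> * epow (q x) (1 - ?\<alpha>)"
  let ?A = "\<integral>\<^sup>+x. \<tau> x \<partial>Q" and ?B = "\<integral>\<^sup>+x. epow (\<tau> x) c \<partial>P"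
  have ren: "renyi ?\<alpha> P Q = renyi_pos ?\<alpha> P Q" using c by (simp add: renyi_def)
  have coeff: "1 / (1 - c) * (1 / (?\<alpha> * (?\<alpha> - 1))) = (1 - c) / c"
  proof -
    have "?\<alpha> - 1 = c / (1 - c)" using c by (simp add: field_simps)
    then show ?thesis using c by simp
  qed
  have R: "?R = - (ereal ((1 - c) / c) * elog (hellinger_integral ?\<alpha> P Q))"
    if "\<not> (?\<alpha> > 1 \<and> \<not> absolutely_continuous Q P)"
    unfolding coeff[symmetric] times_ereal.simps(1)[symmetric] mult.assoc
    using that by (simp only: ren renyi_pos_eq_hellinger_integral if_False)
  consider "c > 0" "absolutely_continuous Q P" | "c > 0" "\<not> absolutely_continuous Q P" | "c < 0"
    using c by linarith
  then show ?thesis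
  proof cases
    case 1
    have "?B = (\<integral>\<^sup>+x. epow (\<tau> x) c * p x \<partial>\<nu>)"
      by (simp add: nn_integral_P)
    \<comment> \<open>Here \<open>P\<close> has to be dominated by \<open>Q\<close>, hence the
      swapped pair, whose dominating measure is again \<open>\<nu>\<close>.\<close>
    also have "\<dots> \<le> (\<integral>\<^sup>+x. epow (\<tau> x * q x) c * epow (?h x) (1 - c) \<partial>\<nu>)"
      using prob_pair.absolutely_continuous_imp_AE_density_0[OF swap 1(2), unfolded sum_meas_commute] p_finite q_finite
      by (intro nn_integral_mono_AE, eventually_elim) (rule epow_Holder_split_between_0_1[OF 1(1) c(1)], auto)
    also have "\<dots> \<le> epow (\<integral>\<^sup>+x. \<tau> x * q x \<partial>\<nu>) c * epow (\<integral>\<^sup>+x. ?h x \<partial>\<nu>) (1 - c)"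
      using c 1 by (intro nn_integral_Holder) auto
    also have "\<dots> = epow ?A c * epow (hellinger_integral ?\<alpha> P Q) (1 - c)"
      by (simp add: nn_integral_Q hellinger_integral_PQ)
    finally have "elog ?B \<le> ereal c * elog ?A + ereal (1 - c) * elog (hellinger_integral ?\<alpha> P Q)"
      using c 1 by (intro elog_le_weighted_sum) auto
    then show ?thesis
      using R 1 c by (simp add: ladd_le_of_le_pos)
  next
    case 2
    \<comment> \<open>The divergence is infinite, and under \<open>ladd\<close> the bound is
      vacuous.\<close>
    then have "?R = -\<infinity>" using c by (simp add: ren renyi_pos_eq_hellinger_integral)
    then show ?thesis by (cases ?X) (auto simp: ladd_def)
  next
    case 3
    have \<alpha>: "0 < ?\<alpha>" "?\<alpha> < 1" using 3 by auto
    show ?thesis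
    proof (cases "?A = top \<or> ?B = top")
      case True
      \<comment> \<open>If \<open>?A\<close> is infinite the claim is trivial; if \<open>?B\<close>
        is, the factor \<open>1 / c < 0\<close> makes the left side -\<infinity>.\<close>
      have "ladd (-\<infinity>) r = -\<infinity>" for r by (cases r) (auto simp: ladd_def)
      then show ?thesis using True 3 by auto
    next
      case False
      \<comment> \<open>Finiteness of \<open>?B\<close> keeps \<open>\<tau>\<close> off
        \<open>0\<close> for \<open>P\<close>, and finiteness of \<open>?A\<close> keeps it off
        \<open>top\<close> for \<open>Q\<close>, as the factorisation for negative \<open>c\<close>
        requires.\<close>
      have "AE x in P. epow (\<tau> x) c \<noteq> \<infinity>"
        using False by (intro nn_integral_noteq_infinite) auto
      then have "AE x in P. \<tau> x \<noteq> 0"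
        by eventually_elim (use 3 in auto)
      then have t0: "AE x in \<nu>. \<tau> x = 0 \<longrightarrow> p x = 0"
        using AE_P_iff[of "\<lambda>x. \<tau> x \<noteq> 0"] by (auto elim!: eventually_mono)
      have "AE x in Q. \<tau> x \<noteq> \<infinity>"
        using False sets_eq by (intro nn_integral_noteq_infinite) (auto cong: measurable_cong_sets)
      then have ttop: "AE x in \<nu>. \<tau> x = top \<longrightarrow> q x = 0"
        by (auto simp: AE_Q_iff elim!: eventually_mono)
      have "hellinger_integral ?\<alpha> P Q = (\<integral>\<^sup>+x. ?h x \<partial>\<nu>)"
        by (rule hellinger_integral_PQ)
      also have "\<dots> \<le> (\<integral>\<^sup>+x. epow (epow (\<tau> x) c * p x) ?\<alpha> * epow (\<tau> x * q x) (1 - ?\<alpha>) \<partial>\<nu>)"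
        using t0 ttop p_finite q_finite
        by (intro nn_integral_mono_AE, eventually_elim) (rule epow_Holder_split_neg[OF 3], auto)
      also have "\<dots> \<le> epow (\<integral>\<^sup>+x. epow (\<tau> x) c * p x \<partial>\<nu>) ?\<alpha> * epow (\<integral>\<^sup>+x. \<tau> x * q x \<partial>\<nu>) (1 - ?\<alpha>)"
        using \<alpha> by (intro nn_integral_Holder) auto
      also have "\<dots> = epow ?B ?\<alpha> * epow ?A (1 - ?\<alpha>)"
        by (simp add: nn_integral_Q nn_integral_P)
      finally have "elog (hellinger_integral ?\<alpha> P Q) \<le> ereal ?\<alpha> * elog ?B + ereal (1 - ?\<alpha>) * elog ?A"
        using \<alpha> by (intro elog_le_weighted_sum) auto
      then show ?thesis
        using R 3 \<alpha> False by (simp add: ladd_le_of_le_neg)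
    qed
  qed
qed

end

section \<open>The tilted measure\<close>

text \<open>By the chain rule \<open>q\<close> is \<open>p * g\<close>, and where \<open>p\<close>
  is positive its two powers multiply to \<open>p\<close>. The second formula keeps an indicator
  because a negative power of \<open>g = 0\<close> is \<open>top\<close>.\<close>

lemma
  assumes "prob_space P" and Q: "prob_space (density P g)" and [measurable]: "g \<in> borel_measurable P"
  shows hellinger_integral_density_base:
      "hellinger_integral \<alpha> (density P g) P = (\<integral>\<^sup>+x. epow (g x) \<alpha> \<partial>P)"
    and hellinger_integral_base_density:
      "hellinger_integral \<alpha> P (density P g)
        = (\<integral>\<^sup>+x. indicator {0<..} (g x) * epow (g x) (1 - \<alpha>) \<partial>P)"
proof -
  interpret prob_pair P "density P g"
    using assms by (simp add: prob_pair_def)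
  have "density \<nu> (\<lambda>x. p x * g x) = density (density \<nu> p) g"
    by (rule density_density_eq[symmetric]) auto
  also have "\<dots> = density P g"
    by (simp only: density_p)
  finally have q_eq: "AE x in \<nu>. p x * g x = q x"
    by (intro nu.RN_deriv_unique) auto
  have "hellinger_integral \<alpha> (density P g) P = (\<integral>\<^sup>+x. epow (g x) \<alpha> * p x \<partial>\<nu>)"
    unfolding hellinger_integral_def
  proof (rule nn_integral_cong_AE)
    show "AE x in \<nu>. indicator {0<..} (p x) * epow (q x) \<alpha> * epow (p x) (1 - \<alpha>) = epow (g x) \<alpha> * p x"
      using q_eq p_finite
    proof eventually_elim
      case (elim x)
      have "epow (q x) \<alpha> * epow (p x) (1 - \<alpha>) = epow (g x) \<alpha> * p x" if "0 < p x"
        using that elim(2) epow_mult[of "p x" "g x" \<alpha>] epow_add[of "p x" \<alpha> "1 - \<alpha>"]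
        by (simp add: elim(1)[symmetric] mult.assoc mult.commute[of "p x"])
      then show ?case by (cases "0 < p x") (auto simp: not_less)
    qed
  qed
  then show "hellinger_integral \<alpha> (density P g) P = (\<integral>\<^sup>+x. epow (g x) \<alpha> \<partial>P)"
    by (simp add: nn_integral_P)
  have "hellinger_integral \<alpha> P (density P g)
    = (\<integral>\<^sup>+x. indicator {0<..} (g x) * epow (g x) (1 - \<alpha>) * p x \<partial>\<nu>)"
    unfolding hellinger_integral_PQ
  proof (rule nn_integral_cong_AE)
    show "AE x in \<nu>. indicator {0<..} (q x) * epow (p x) \<alpha> * epow (q x) (1 - \<alpha>)
      = indicator {0<..} (g x) * epow (g x) (1 - \<alpha>) * p x"
      using q_eq p_finite
    proof eventually_elim
      case (elim x)
      have "epow (p x) \<alpha> * epow (q x) (1 - \<alpha>) = epow (g x) (1 - \<alpha>) * p x" if "0 < p x"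
      proof -
        have "epow (p x) \<alpha> * epow (q x) (1 - \<alpha>) = epow (g x) (1 - \<alpha>) * (epow (p x) \<alpha> * epow (p x) (1 - \<alpha>))"
          using that elim(2) epow_mult[of "p x" "g x" "1 - \<alpha>"]
          by (simp add: elim(1)[symmetric] mult.left_commute mult.commute[of "p x"])
        then show ?thesis using that elim(2) epow_add[of "p x" \<alpha> "1 - \<alpha>"] by simp
      qed
      moreover have "0 < q x \<longleftrightarrow> 0 < p x \<and> 0 < g x"
        unfolding elim(1)[symmetric] by (auto simp: ennreal_zero_less_mult_iff)
      ultimately show ?case
        by (cases "0 < p x"; cases "0 < g x") (auto simp: not_less mult.assoc indicator_def)
    qed
  qed
  then show "hellinger_integral \<alpha> P (density P g)
        = (\<integral>\<^sup>+x. indicator {0<..} (g x) * epow (g x) (1 - \<alpha>) \<partial>P)"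
    by (simp add: nn_integral_P)
qed

text \<open>The normalising integral is carried as a positive real \<open>z\<close>, so that
  dividing by it becomes multiplying by the finite factor \<open>ennreal (1 / z)\<close>.\<close>

locale tilted_measure = P: prob_space P for P :: "'a measure" +
  fixes \<tau> :: "'a \<Rightarrow> ennreal" and \<gamma> z :: real
  assumes tau [measurable]: "\<tau> \<in> borel_measurable P"
    and gamma: "\<gamma> \<noteq> 0" "\<gamma> \<noteq> -1"
    and z_pos: "0 < z"
    and Z_eq: "(\<integral>\<^sup>+ x. epow (\<tau> x) \<gamma> \<partial>P) = ennreal z"
begin

abbreviation "Q\<gamma> \<equiv> Qgam P \<tau> \<gamma>"
abbreviation "W \<equiv> \<integral>\<^sup>+ x. epow (\<tau> x) (\<gamma> + 1) \<partial>P"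

lemma Q\<gamma>_eq: "Q\<gamma> = density P (\<lambda>x. epow (\<tau> x) \<gamma> * ennreal (1 / z))"
  using z_pos by (simp add: Qgam_def Z_eq divide_ennreal_def inverse_ennreal inverse_eq_divide)

lemma prob_space_Q\<gamma>: "prob_space Q\<gamma>"
proof
  have "emeasure Q\<gamma> (space P) = (\<integral>\<^sup>+ x. epow (\<tau> x) \<gamma> * ennreal (1 / z) \<partial>P)"
    unfolding Q\<gamma>_eq by (subst emeasure_density) (auto intro!: nn_integral_cong)
  also have "\<dots> = 1"
    using z_pos by (simp add: nn_integral_multc Z_eq ennreal_mult[symmetric])
  finally show "emeasure Q\<gamma> (space Q\<gamma>) = 1" by (simp add: Q\<gamma>_eq)
qed

lemma Q\<gamma>_in_probs: "Q\<gamma> \<in> probs P"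
  using prob_space_Q\<gamma> by (simp add: probs_def Q\<gamma>_eq)

lemma prob_pair_probs: "Q \<in> probs P \<Longrightarrow> prob_pair P Q"
  by (simp add: probs_def prob_pair_def P.prob_space_axioms)

lemma absolutely_continuous_Q\<gamma>: "absolutely_continuous P Q\<gamma>"
  unfolding Q\<gamma>_eq by (rule absolutely_continuousI_density) simp

text \<open>The hypothesis can fail at extreme values: its left side is \<open>0\<close> and its
  right side \<open>top\<close> at \<open>\<tau> x = 0\<close> for \<open>\<gamma> < -1\<close>, and
  at \<open>\<tau> x = top\<close> for \<open>-1 < \<gamma> < 0\<close>.\<close>

lemma nn_integral_Q\<gamma>:
  assumes "AE x in P. \<tau> x * epow (\<tau> x) \<gamma> = epow (\<tau> x) (\<gamma> + 1)"
  shows "(\<integral>\<^sup>+ x. \<tau> x \<partial>Q\<gamma>) = W * ennreal (1 / z)"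
proof -
  have "(\<integral>\<^sup>+ x. \<tau> x \<partial>Q\<gamma>) = (\<integral>\<^sup>+ x. epow (\<tau> x) \<gamma> * ennreal (1 / z) * \<tau> x \<partial>P)"
    unfolding Q\<gamma>_eq by (rule nn_integral_density) auto
  also have "\<dots> = (\<integral>\<^sup>+ x. epow (\<tau> x) (\<gamma> + 1) * ennreal (1 / z) \<partial>P)"
    using assms by (intro nn_integral_cong_AE, eventually_elim) (metis mult.assoc mult.commute)
  also have "\<dots> = W * ennreal (1 / z)"
    by (rule nn_integral_multc) simp
  finally show ?thesis .
qed

lemma epow_density:
  "epow (epow t \<gamma> * ennreal (1 / z)) s = epow t (\<gamma> * s) * ennreal ((1 / z) powr s)"
  using z_pos by (simp add: epow_mult epow_epow)

lemma hellinger_integral_Q\<gamma>_P: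
  "hellinger_integral \<alpha> Q\<gamma> P = (\<integral>\<^sup>+ x. epow (\<tau> x) (\<gamma> * \<alpha>) \<partial>P) * ennreal ((1 / z) powr \<alpha>)"
  unfolding Q\<gamma>_eq using prob_space_Q\<gamma> P.prob_space_axioms
  by (subst hellinger_integral_density_base) (auto simp: Q\<gamma>_eq epow_density nn_integral_multc)

lemma hellinger_integral_P_Q\<gamma>:
  assumes "\<alpha> < 1 \<or> (AE x in P. 0 < epow (\<tau> x) \<gamma>)"
  shows "hellinger_integral \<alpha> P Q\<gamma>
    = (\<integral>\<^sup>+ x. epow (\<tau> x) (\<gamma> * (1 - \<alpha>)) \<partial>P) * ennreal ((1 / z) powr (1 - \<alpha>))"
proof -
  let ?g = "\<lambda>x. epow (\<tau> x) \<gamma> * ennreal (1 / z)"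
  have "AE x in P. indicator {0<..} (?g x) * epow (?g x) (1 - \<alpha>) = epow (?g x) (1 - \<alpha>)"
    using assms
  proof
    assume "\<alpha> < 1"
    then show ?thesis by (intro AE_I2) (auto simp: indicator_def not_less)
  next
    assume "AE x in P. 0 < epow (\<tau> x) \<gamma>"
    then show ?thesis
      by eventually_elim (use z_pos in \<open>auto simp: indicator_def ennreal_zero_less_mult_iff\<close>)
  qed
  then have "hellinger_integral \<alpha> P Q\<gamma> = (\<integral>\<^sup>+ x. epow (?g x) (1 - \<alpha>) \<partial>P)"
    unfolding Q\<gamma>_eq using prob_space_Q\<gamma> P.prob_space_axioms
    by (subst hellinger_integral_base_density) (auto simp: Q\<gamma>_eq intro: nn_integral_cong_AE)
  then show ?thesis by (simp add: epow_density nn_integral_multc)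
qed

section \<open>Equality in the bounds at c = \<gamma> + 1\<close>

lemma renyi_bound_attained_pos:
  assumes "\<gamma> > 0"
  shows "ereal (1 / (\<gamma> + 1)) * elog W + ereal (1 / \<gamma>) * renyi ((\<gamma> + 1) / \<gamma>) Q\<gamma> P
    = elog (\<integral>\<^sup>+ x. \<tau> x \<partial>Q\<gamma>)"
proof -
  have "AE x in P. \<tau> x * epow (\<tau> x) \<gamma> = epow (\<tau> x) (\<gamma> + 1)"
  proof (intro AE_I2)
    fix x show "\<tau> x * epow (\<tau> x) \<gamma> = epow (\<tau> x) (\<gamma> + 1)"
      using assms epow_add[of "\<tau> x" 1 \<gamma>]
      by (cases "\<tau> x" rule: ennreal_zero_pos_top_cases) (auto simp: add.commute)
  qed
  note int = nn_integral_Q\<gamma>[OF this]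
  \<comment> \<open>Otherwise \<open>\<tau>\<close> would vanish almost everywhere, and with it the
    normalising integral.\<close>
  have W_nz: "W \<noteq> 0"
  proof
    assume "W = 0"
    then have "AE x in P. epow (\<tau> x) (\<gamma> + 1) = 0" by (simp add: nn_integral_0_iff_AE)
    then have "AE x in P. epow (\<tau> x) \<gamma> = 0"
      by eventually_elim (use assms in \<open>simp add: epow_eq_0_iff\<close>)
    then have "(\<integral>\<^sup>+ x. epow (\<tau> x) \<gamma> \<partial>P) = 0" by (simp add: nn_integral_0_iff_AE)
    then show False using Z_eq z_pos by simp
  qed
  \<comment> \<open>This is the order \<open>c / (c - 1)\<close> at \<open>c = \<gamma> + 1\<close>.
    Since \<open>\<gamma> * \<alpha> = \<gamma> + 1\<close>, the Hellinger integral is a multiple of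
    \<open>W\<close>.\<close>
  define \<alpha> where "\<alpha> = (\<gamma> + 1) / \<gamma>"
  have \<alpha>: "\<alpha> > 1" "\<gamma> * \<alpha> = \<gamma> + 1" using assms by (auto simp: \<alpha>_def field_simps)
  have hell: "hellinger_integral \<alpha> Q\<gamma> P = W * ennreal ((1 / z) powr \<alpha>)"
    using hellinger_integral_Q\<gamma>_P[of \<alpha>] \<alpha> by simp
  have ren: "renyi \<alpha> Q\<gamma> P = ereal (1 / (\<alpha> * (\<alpha> - 1))) * elog (W * ennreal ((1 / z) powr \<alpha>))"
    using \<alpha> absolutely_continuous_Q\<gamma> by (simp add: renyi_def renyi_pos_eq_hellinger_integral hell)
  show ?thesis
  proof (cases W rule: ennreal_zero_pos_top_cases)
    case top
    then show ?thesis
      using assms z_pos \<alpha> by (simp add: ren \<alpha>_def[symmetric] int ennreal_top_mult)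
  next
    case (pos w)
    have "1 / (\<gamma> + 1) * ln w + 1 / \<gamma> * (1 / (\<alpha> * (\<alpha> - 1)) * (ln w - \<alpha> * ln z)) = ln w - ln z"
    proof -
      have "\<alpha> - 1 = 1 / \<gamma>" using assms by (simp add: \<alpha>_def field_simps)
      then have "1 / \<gamma> * (1 / (\<alpha> * (\<alpha> - 1))) = 1 / \<alpha>" using assms by simp
      moreover have "1 / (\<gamma> + 1) = 1 - 1 / \<alpha>" using assms by (simp add: \<alpha>_def field_simps)
      ultimately have "1 / (\<gamma> + 1) * ln w + 1 / \<gamma> * (1 / (\<alpha> * (\<alpha> - 1)) * (ln w - \<alpha> * ln z))
        = (1 - 1 / \<alpha>) * ln w + 1 / \<alpha> * (ln w - \<alpha> * ln z)"
        by (metis mult.assoc)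
      also have "\<dots> = ln w - ln z" using \<alpha> by (simp add: algebra_simps diff_divide_distrib)
      finally show ?thesis .
    qed
    then show ?thesis
      using pos z_pos by (simp add: ren \<alpha>_def[symmetric] int ennreal_mult[symmetric] ln_mult ln_powr ln_div)
  qed (use W_nz in auto)
qed

text \<open>A negative power is infinite at \<open>0\<close>, which a finite integral allows only on
  a null set.\<close>

lemma AE_tau_pos:
  assumes "\<gamma> < 0"
  shows "AE x in P. \<tau> x \<noteq> 0"
proof -
  have "AE x in P. epow (\<tau> x) \<gamma> \<noteq> \<infinity>"
    using Z_eq by (intro nn_integral_noteq_infinite) auto
  then show ?thesis by eventually_elim (use assms in auto)
qed

text \<open>If \<open>W = 0\<close>, then almost everywhere \<open>\<tau>\<close> is infinite when
  \<open>\<gamma> < -1\<close>, contradicting \<open>0 < z\<close>, and zero when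
  \<open>-1 < \<gamma>\<close>, contradicting \<open>AE_tau_pos\<close>. Finiteness comes from
  \<open>epow_succ_le\<close> or from \<open>fin\<close>.\<close>

lemma W_finite_pos:
  assumes neg: "\<gamma> < 0" and fin: "\<gamma> < -1 \<or> (AE x in P. \<tau> x < \<infinity>) \<and> W < \<infinity>"
  obtains w where "0 < w" "W = ennreal w"
proof (cases W rule: ennreal_zero_pos_top_cases)
  case zero
  then have W0: "AE x in P. epow (\<tau> x) (\<gamma> + 1) = 0" by (simp add: nn_integral_0_iff_AE)
  show ?thesis
  proof (cases "\<gamma> < -1")
    case True
    have "AE x in P. epow (\<tau> x) \<gamma> = 0"
      using W0
    proof eventually_elim
      case (elim x)
      then show ?case using True
        by (cases "\<tau> x" rule: ennreal_zero_pos_top_cases) auto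
    qed
    then have "(\<integral>\<^sup>+ x. epow (\<tau> x) \<gamma> \<partial>P) = 0" by (simp add: nn_integral_0_iff_AE)
    then show ?thesis using Z_eq z_pos by simp
  next
    case False
    then have "\<gamma> + 1 > 0" using gamma by simp
    have "AE x in P. False"
      using W0 AE_tau_pos[OF neg]
      by eventually_elim (use \<open>\<gamma> + 1 > 0\<close> in \<open>simp add: epow_eq_0_iff\<close>)
    then show ?thesis by simp
  qed
next
  case top
  have "W < top"
  proof (cases "\<gamma> < -1")
    case True
    have "W \<le> (\<integral>\<^sup>+ x. 1 + epow (\<tau> x) \<gamma> \<partial>P)"
      by (intro nn_integral_mono epow_succ_le True)
    also have "\<dots> = 1 + ennreal z"
      by (simp add: nn_integral_add Z_eq P.emeasure_space_1)
    also have "\<dots> < top" by simp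
    finally show ?thesis .
  qed (use fin in auto)
  with top show ?thesis by simp
qed (use that in auto)

lemma renyi_bound_attained_neg:
  assumes neg: "\<gamma> < 0" and fin: "\<gamma> < -1 \<or> (AE x in P. \<tau> x < \<infinity>) \<and> W < \<infinity>"
  shows "ladd (ereal (1 / (\<gamma> + 1)) * elog W) (- (ereal (1 / - \<gamma>) * renyi (1 / - \<gamma>) P Q\<gamma>))
    = elog (\<integral>\<^sup>+ x. \<tau> x \<partial>Q\<gamma>)"
proof -
  obtain w where w: "0 < w" "W = ennreal w" using W_finite_pos[OF assms] .
  \<comment> \<open>Infinite values of \<open>\<tau>\<close> survive only for
    \<open>\<gamma> < -1\<close>, where they give \<open>0\<close> on both sides of the product rule
    for powers.\<close>
  have tau_top: "AE x in P. \<tau> x = top \<longrightarrow> \<gamma> < -1"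
    using fin
  proof (elim disjE conjE)
    assume "AE x in P. \<tau> x < \<infinity>"
    then show ?thesis by eventually_elim auto
  qed auto
  have "AE x in P. \<tau> x * epow (\<tau> x) \<gamma> = epow (\<tau> x) (\<gamma> + 1)"
    using AE_tau_pos[OF neg] tau_top
  proof eventually_elim
    case (elim x)
    then show ?case
      using neg epow_add[of "\<tau> x" 1 \<gamma>]
      by (cases "\<tau> x" rule: ennreal_zero_pos_top_cases) (auto simp: add.commute)
  qed
  note int = nn_integral_Q\<gamma>[OF this]
  define \<alpha> where "\<alpha> = 1 / - \<gamma>"
  have \<alpha>: "\<alpha> > 0" "\<alpha> \<noteq> 1" "\<gamma> * (1 - \<alpha>) = \<gamma> + 1"
    using neg gamma by (auto simp: \<alpha>_def field_simps)
  have g_pos: "AE x in P. 0 < epow (\<tau> x) \<gamma>" if "\<not> \<gamma> < -1"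
    using AE_tau_pos[OF neg] tau_top
  proof eventually_elim
    case (elim x)
    then show ?case using that
      by (cases "\<tau> x" rule: ennreal_zero_pos_top_cases) auto
  qed
  have \<alpha>1: "\<alpha> < 1 \<longleftrightarrow> \<gamma> < -1"
    using neg by (simp add: \<alpha>_def field_simps)
  have hell: "hellinger_integral \<alpha> P Q\<gamma> = W * ennreal ((1 / z) powr (1 - \<alpha>))"
    using hellinger_integral_P_Q\<gamma>[of \<alpha>] \<alpha> g_pos \<alpha>1 by auto
  \<comment> \<open>For order above \<open>1\<close> the divergence is finite only under domination.
    Then \<open>-1 < \<gamma>\<close>, so \<open>\<tau>\<close> is finite and the tilting density
    positive almost everywhere.\<close>
  have ac: "absolutely_continuous Q\<gamma> P" if "\<alpha> > 1"
  proof -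
    have "AE x in P. 0 < epow (\<tau> x) \<gamma> * ennreal (1 / z)"
      using g_pos \<alpha>1 that z_pos by (auto simp: ennreal_zero_less_mult_iff)
    then show ?thesis
      unfolding absolutely_continuous_def Q\<gamma>_eq
    proof (intro subsetI)
      fix A assume pos: "AE x in P. 0 < epow (\<tau> x) \<gamma> * ennreal (1 / z)"
        and "A \<in> null_sets (density P (\<lambda>x. epow (\<tau> x) \<gamma> * ennreal (1 / z)))"
      then have A: "A \<in> sets P" and ae: "AE x in P. x \<in> A \<longrightarrow> epow (\<tau> x) \<gamma> * ennreal (1 / z) = 0"
        by (auto simp: null_sets_density_iff)
      from pos ae have "AE x in P. x \<notin> A" by eventually_elim auto
      with A show "A \<in> null_sets P" by (simp add: AE_iff_null_sets)
    qed
  qed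
  have ren: "renyi \<alpha> P Q\<gamma> = ereal (1 / (\<alpha> * (\<alpha> - 1)) * (ln w - (1 - \<alpha>) * ln z))"
    using \<alpha> ac w z_pos
    by (auto simp: renyi_def renyi_pos_eq_hellinger_integral hell ennreal_mult[symmetric] ln_mult ln_powr ln_div)
  have "1 / (\<gamma> + 1) * ln w - \<alpha> * (1 / (\<alpha> * (\<alpha> - 1)) * (ln w - (1 - \<alpha>) * ln z)) = ln w - ln z"
  proof -
    \<comment> \<open>With this reciprocal \<open>1 / (\<gamma> + 1)\<close> is
      \<open>1 + d\<close>, and the claim follows from
      \<open>d * (\<alpha> - 1) = 1\<close>.\<close>
    define d where "d = 1 / (\<alpha> - 1)"
    have d: "d * (\<alpha> - 1) = 1" using \<alpha> by (simp add: d_def)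
    have "1 / (\<gamma> + 1) = 1 + d"
      using neg gamma by (simp add: d_def \<alpha>_def field_simps)
    moreover have "\<alpha> * (1 / (\<alpha> * (\<alpha> - 1)) * (ln w - (1 - \<alpha>) * ln z)) = d * (ln w - (1 - \<alpha>) * ln z)"
      using \<alpha> by (simp add: d_def)
    moreover have "(1 + d) * ln w - d * (ln w - (1 - \<alpha>) * ln z) = ln w - ln z"
      using d by algebra
    ultimately show ?thesis by simp
  qed
  then show ?thesis
    unfolding \<alpha>_def[symmetric] ren using w z_pos
    by (simp add: int ennreal_mult[symmetric] ln_mult ln_div ladd_def)
qed

section \<open>Optimality of the tilted measure over divergence balls\<close>

lemma elog_integral_le_U_beta:
  assumes "\<gamma> > 0" "Q \<in> U_beta P \<tau> \<gamma> (1 + 1 / \<gamma>)"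
  shows "elog (\<integral>\<^sup>+ x. \<tau> x \<partial>Q) \<le> elog (\<integral>\<^sup>+ x. \<tau> x \<partial>Q\<gamma>)"
proof -
  have Q: "Q \<in> probs P" and le: "renyi ((\<gamma> + 1) / \<gamma>) Q P \<le> renyi ((\<gamma> + 1) / \<gamma>) Q\<gamma> P"
    using assms by (auto simp: U_beta_def add_divide_distrib)
  \<comment> \<open>At \<open>c = \<gamma> + 1\<close> the bound depends on \<open>Q\<close> only
    through the divergence that the ball controls, and it is attained by
    \<open>Q\<gamma>\<close>.\<close>
  have "elog (\<integral>\<^sup>+ x. \<tau> x \<partial>Q)
      \<le> ereal (1 / (\<gamma> + 1)) * elog W + ereal (1 / \<gamma>) * renyi ((\<gamma> + 1) / \<gamma>) Q P"
    using prob_pair.elog_integral_le_renyi[OF prob_pair_probs[OF Q], of "\<gamma> + 1" \<tau>] assms by simp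
  also have "\<dots> \<le> ereal (1 / (\<gamma> + 1)) * elog W + ereal (1 / \<gamma>) * renyi ((\<gamma> + 1) / \<gamma>) Q\<gamma> P"
    using assms le by (intro add_left_mono ereal_mult_left_mono) auto
  finally show ?thesis using renyi_bound_attained_pos assms by simp
qed

lemma elog_integral_ge_U_beta:
  assumes neg: "\<gamma> < 0" and fin: "\<gamma> < -1 \<or> (AE x in P. \<tau> x < \<infinity>) \<and> W < \<infinity>"
    and "Q \<in> U_beta P \<tau> \<gamma> (1 + 1 / \<gamma>)"
  shows "elog (\<integral>\<^sup>+ x. \<tau> x \<partial>Q\<gamma>) \<le> elog (\<integral>\<^sup>+ x. \<tau> x \<partial>Q)"
proof -
  have Q: "Q \<in> probs P" and le: "renyi (1 + 1 / \<gamma>) Q P \<le> renyi (1 + 1 / \<gamma>) Q\<gamma> P"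
    using assms by (auto simp: U_beta_def)
  \<comment> \<open>The lower bound involves the divergence of \<open>P\<close> from
    \<open>Q\<close> at order \<open>-1 / \<gamma>\<close>; skew symmetry turns it into the one
    defining the ball.\<close>
  have skew: "renyi (1 / - \<gamma>) P Q' = renyi (1 + 1 / \<gamma>) Q' P" if "Q' \<in> probs P" for Q'
    using prob_pair.renyi_skew_symmetry[OF prob_pair_probs[OF that], of "1 + 1 / \<gamma>"] by simp
  have "elog (\<integral>\<^sup>+ x. \<tau> x \<partial>Q\<gamma>)
    = ladd (ereal (1 / (\<gamma> + 1)) * elog W) (- (ereal (1 / - \<gamma>) * renyi (1 / - \<gamma>) P Q\<gamma>))"
    using renyi_bound_attained_neg[OF neg fin] by simp
  also have "\<dots> \<le> ladd (ereal (1 / (\<gamma> + 1)) * elog W) (- (ereal (1 / - \<gamma>) * renyi (1 / - \<gamma>) P Q))"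
    unfolding skew[OF Q] skew[OF Q\<gamma>_in_probs] ereal_minus_le_minus using neg le
    by (intro ladd_mono_right) (simp only: ereal_minus_le_minus, intro ereal_mult_left_mono, auto)
  also have "\<dots> \<le> elog (\<integral>\<^sup>+ x. \<tau> x \<partial>Q)"
    using prob_pair.renyi_le_elog_integral[OF prob_pair_probs[OF Q], of "\<gamma> + 1" \<tau>] neg gamma by simp
  finally show ?thesis .
qed

section \<open>Extrema over neighbourhoods and over the exponent c\<close>

lemma Q\<gamma>_in_U_set: "Q\<gamma> \<in> U_set P \<tau> \<gamma> I"
  using Q\<gamma>_in_probs by (simp add: U_set_def)

lemma U_set_subset_U_beta: "\<beta> \<in> I \<Longrightarrow> U_set P \<tau> \<gamma> I \<subseteq> U_beta P \<tau> \<gamma> \<beta>"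
  by (auto simp: U_set_def U_beta_def)

lemma SUP_U_beta_eq:
  assumes "\<gamma> > 0"
  shows "(SUP Q\<in>U_beta P \<tau> \<gamma> (1 + 1 / \<gamma>). elog (\<integral>\<^sup>+ x. \<tau> x \<partial>Q)) = elog (\<integral>\<^sup>+ x. \<tau> x \<partial>Q\<gamma>)"
  using elog_integral_le_U_beta[OF assms] Q\<gamma>_in_probs
  by (intro cSup_eq_maximum) (auto simp: U_beta_def)

text \<open>The set is contained in the ball of order \<open>1 + 1 / \<gamma>\<close> and still
  contains the maximiser \<open>Q\<gamma>\<close>.\<close>

lemma SUP_U_set_eq:
  assumes "\<gamma> > 0" "1 + 1 / \<gamma> \<in> I"
  shows "(SUP Q\<in>U_set P \<tau> \<gamma> I. elog (\<integral>\<^sup>+ x. \<tau> x \<partial>Q)) = elog (\<integral>\<^sup>+ x. \<tau> x \<partial>Q\<gamma>)"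
  using elog_integral_le_U_beta[OF assms(1)] U_set_subset_U_beta[OF assms(2)] Q\<gamma>_in_U_set[of I]
  by (intro cSup_eq_maximum) auto

lemma INF_U_beta_eq:
  assumes "\<gamma> < 0" "\<gamma> < -1 \<or> (AE x in P. \<tau> x < \<infinity>) \<and> W < \<infinity>"
  shows "(INF Q\<in>U_beta P \<tau> \<gamma> (1 + 1 / \<gamma>). elog (\<integral>\<^sup>+ x. \<tau> x \<partial>Q)) = elog (\<integral>\<^sup>+ x. \<tau> x \<partial>Q\<gamma>)"
  using elog_integral_ge_U_beta[OF assms] Q\<gamma>_in_probs
  by (intro cInf_eq_minimum) (auto simp: U_beta_def)

lemma INF_U_set_eq:
  assumes "\<gamma> < 0" "\<gamma> < -1 \<or> (AE x in P. \<tau> x < \<infinity>) \<and> W < \<infinity>" "1 + 1 / \<gamma> \<in> I"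
  shows "(INF Q\<in>U_set P \<tau> \<gamma> I. elog (\<integral>\<^sup>+ x. \<tau> x \<partial>Q)) = elog (\<integral>\<^sup>+ x. \<tau> x \<partial>Q\<gamma>)"
  using elog_integral_ge_U_beta[OF assms(1,2)] U_set_subset_U_beta[OF assms(3)] Q\<gamma>_in_U_set[of I]
  by (intro cInf_eq_minimum) auto

text \<open>The bound is now applied to \<open>Q\<gamma>\<close> itself with \<open>c\<close>
  varying: each \<open>c\<close> bounds from above, and \<open>c = \<gamma> + 1\<close>
  attains.\<close>

lemma INF_renyi_bound_eq:
  assumes "\<gamma> > 0"
  shows "(INF c\<in>{1<..}. ereal (1 / c) * elog (\<integral>\<^sup>+ x. epow (\<tau> x) c \<partial>P)
    + ereal (1 / (c - 1)) * renyi (c / (c - 1)) Q\<gamma> P) = elog (\<integral>\<^sup>+ x. \<tau> x \<partial>Q\<gamma>)"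
proof (rule cInf_eq_minimum)
  show "elog (\<integral>\<^sup>+ x. \<tau> x \<partial>Q\<gamma>) \<in> (\<lambda>c. ereal (1 / c) * elog (\<integral>\<^sup>+ x. epow (\<tau> x) c \<partial>P)
    + ereal (1 / (c - 1)) * renyi (c / (c - 1)) Q\<gamma> P) ` {1<..}"
    using renyi_bound_attained_pos[OF assms] assms by (intro image_eqI[of _ _ "\<gamma> + 1"]) auto
qed (use prob_pair.elog_integral_le_renyi[OF prob_pair_probs[OF Q\<gamma>_in_probs] _ tau] in blast)

lemma SUP_renyi_bound_eq:
  assumes "\<gamma> < 0" "\<gamma> < -1 \<or> (AE x in P. \<tau> x < \<infinity>) \<and> W < \<infinity>"
  shows "(SUP c\<in>{c. c < 1 \<and> c \<noteq> 0}. ladd (ereal (1 / c) * elog (\<integral>\<^sup>+ x. epow (\<tau> x) c \<partial>P))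
    (- (ereal (1 / (1 - c)) * renyi (1 / (1 - c)) P Q\<gamma>))) = elog (\<integral>\<^sup>+ x. \<tau> x \<partial>Q\<gamma>)"
proof (rule cSup_eq_maximum)
  show "elog (\<integral>\<^sup>+ x. \<tau> x \<partial>Q\<gamma>) \<in> (\<lambda>c. ladd (ereal (1 / c) * elog (\<integral>\<^sup>+ x. epow (\<tau> x) c \<partial>P))
    (- (ereal (1 / (1 - c)) * renyi (1 / (1 - c)) P Q\<gamma>))) ` {c. c < 1 \<and> c \<noteq> 0}"
  proof (rule image_eqI[of _ _ "\<gamma> + 1"])
    have "1 - (\<gamma> + 1) = - \<gamma>" by simp
    then show "elog (\<integral>\<^sup>+ x. \<tau> x \<partial>Q\<gamma>) = ladd (ereal (1 / (\<gamma> + 1)) * elog W)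
      (- (ereal (1 / (1 - (\<gamma> + 1))) * renyi (1 / (1 - (\<gamma> + 1))) P Q\<gamma>))"
      by (simp only: renyi_bound_attained_neg[OF assms])
    show "\<gamma> + 1 \<in> {c. c < 1 \<and> c \<noteq> 0}"
      using assms gamma by auto
  qed
qed (use prob_pair.renyi_le_elog_integral[OF prob_pair_probs[OF Q\<gamma>_in_probs] _ _ tau] in blast)

end

theorem mainTheorem13:
  fixes P :: "'a measure" and \<tau> :: "'a \<Rightarrow> ennreal" and \<gamma> :: real
  assumes P: "prob_space P"
    and \<tau>: "\<tau> \<in> borel_measurable P"
    and g0: "\<gamma> \<noteq> 0" and g1: "\<gamma> \<noteq> -1"
    and Zpos: "0 < (\<integral>\<^sup>+ x. epow (\<tau> x) \<gamma> \<partial>P)"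
    and Zfin: "(\<integral>\<^sup>+ x. epow (\<tau> x) \<gamma> \<partial>P) < \<infinity>"
  shows
    "(\<forall>I \<beta>. \<beta> \<in> I \<longrightarrow>
        Qgam P \<tau> \<gamma> \<in> U_set P \<tau> \<gamma> I \<and> U_set P \<tau> \<gamma> I \<subseteq> U_beta P \<tau> \<gamma> \<beta>)
   \<and> (\<gamma> > 0 \<longrightarrow>
        (SUP Q\<in>U_set P \<tau> \<gamma> {1<..}. elog (\<integral>\<^sup>+ x. \<tau> x \<partial>Q))
          = (SUP Q\<in>U_beta P \<tau> \<gamma> (1 + 1 / \<gamma>). elog (\<integral>\<^sup>+ x. \<tau> x \<partial>Q))
      \<and> (SUP Q\<in>U_beta P \<tau> \<gamma> (1 + 1 / \<gamma>). elog (\<integral>\<^sup>+ x. \<tau> x \<partial>Q))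
          = elog (\<integral>\<^sup>+ x. \<tau> x \<partial>Qgam P \<tau> \<gamma>)
      \<and> elog (\<integral>\<^sup>+ x. \<tau> x \<partial>Qgam P \<tau> \<gamma>)
          = (INF c\<in>{1<..}. ereal (1 / c) * elog (\<integral>\<^sup>+ x. epow (\<tau> x) c \<partial>P)
                            + ereal (1 / (c - 1)) * renyi (c / (c - 1)) (Qgam P \<tau> \<gamma>) P)
      \<and> (INF c\<in>{1<..}. ereal (1 / c) * elog (\<integral>\<^sup>+ x. epow (\<tau> x) c \<partial>P)
                            + ereal (1 / (c - 1)) * renyi (c / (c - 1)) (Qgam P \<tau> \<gamma>) P)
          = (let c = \<gamma> + 1 in ereal (1 / c) * elog (\<integral>\<^sup>+ x. epow (\<tau> x) c \<partial>P)
                            + ereal (1 / (c - 1)) * renyi (c / (c - 1)) (Qgam P \<tau> \<gamma>) P))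
   \<and> (\<gamma> \<in> {-1<..<0} \<and> (AE x in P. \<tau> x < \<infinity>)
        \<and> (\<integral>\<^sup>+ x. epow (\<tau> x) (\<gamma> + 1) \<partial>P) < \<infinity> \<longrightarrow>
        (INF Q\<in>U_set P \<tau> \<gamma> {..<0}. elog (\<integral>\<^sup>+ x. \<tau> x \<partial>Q))
          = (INF Q\<in>U_beta P \<tau> \<gamma> (1 + 1 / \<gamma>). elog (\<integral>\<^sup>+ x. \<tau> x \<partial>Q))
      \<and> (INF Q\<in>U_beta P \<tau> \<gamma> (1 + 1 / \<gamma>). elog (\<integral>\<^sup>+ x. \<tau> x \<partial>Q))
          = elog (\<integral>\<^sup>+ x. \<tau> x \<partial>Qgam P \<tau> \<gamma>)
      \<and> elog (\<integral>\<^sup>+ x. \<tau> x \<partial>Qgam P \<tau> \<gamma>)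
          = (SUP c\<in>{c. c < 1 \<and> c \<noteq> 0}. ladd (ereal (1 / c) * elog (\<integral>\<^sup>+ x. epow (\<tau> x) c \<partial>P))
                            (- (ereal (1 / (1 - c)) * renyi (1 / (1 - c)) P (Qgam P \<tau> \<gamma>))))
      \<and> (SUP c\<in>{c. c < 1 \<and> c \<noteq> 0}. ladd (ereal (1 / c) * elog (\<integral>\<^sup>+ x. epow (\<tau> x) c \<partial>P))
                            (- (ereal (1 / (1 - c)) * renyi (1 / (1 - c)) P (Qgam P \<tau> \<gamma>))))
          = (let c = \<gamma> + 1 in ladd (ereal (1 / c) * elog (\<integral>\<^sup>+ x. epow (\<tau> x) c \<partial>P))
                            (- (ereal (1 / (1 - c)) * renyi (1 / (1 - c)) P (Qgam P \<tau> \<gamma>)))))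
   \<and> (\<gamma> < -1 \<longrightarrow>
        (INF Q\<in>U_set P \<tau> \<gamma> {0<..<1}. elog (\<integral>\<^sup>+ x. \<tau> x \<partial>Q))
          = (INF Q\<in>U_beta P \<tau> \<gamma> (1 + 1 / \<gamma>). elog (\<integral>\<^sup>+ x. \<tau> x \<partial>Q))
      \<and> (INF Q\<in>U_beta P \<tau> \<gamma> (1 + 1 / \<gamma>). elog (\<integral>\<^sup>+ x. \<tau> x \<partial>Q))
          = elog (\<integral>\<^sup>+ x. \<tau> x \<partial>Qgam P \<tau> \<gamma>)
      \<and> elog (\<integral>\<^sup>+ x. \<tau> x \<partial>Qgam P \<tau> \<gamma>)
          = (SUP c\<in>{c. c < 1 \<and> c \<noteq> 0}. ladd (ereal (1 / c) * elog (\<integral>\<^sup>+ x. epow (\<tau> x) c \<partial>P))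
                            (- (ereal (1 / (1 - c)) * renyi (1 / (1 - c)) P (Qgam P \<tau> \<gamma>))))
      \<and> (SUP c\<in>{c. c < 1 \<and> c \<noteq> 0}. ladd (ereal (1 / c) * elog (\<integral>\<^sup>+ x. epow (\<tau> x) c \<partial>P))
                            (- (ereal (1 / (1 - c)) * renyi (1 / (1 - c)) P (Qgam P \<tau> \<gamma>))))
          = (let c = \<gamma> + 1 in ladd (ereal (1 / c) * elog (\<integral>\<^sup>+ x. epow (\<tau> x) c \<partial>P))
                            (- (ereal (1 / (1 - c)) * renyi (1 / (1 - c)) P (Qgam P \<tau> \<gamma>)))))"
proof -
  obtain z where z: "0 < z" "(\<integral>\<^sup>+ x. epow (\<tau> x) \<gamma> \<partial>P) = ennreal z"
    using Zpos Zfin by (cases "\<integral>\<^sup>+ x. epow (\<tau> x) \<gamma> \<partial>P" rule: ennreal_zero_pos_top_cases) auto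
  interpret tilted_measure P \<tau> \<gamma> z
    using P \<tau> g0 g1 z by (simp add: tilted_measure_def tilted_measure_axioms_def)
  \<comment> \<open>The order of the ball belongs to the interval of orders used in each of the
    three cases.\<close>
  have exponent:
    "\<gamma> > 0 \<Longrightarrow> 1 + 1 / \<gamma> \<in> {1<..}"
    "\<gamma> \<in> {-1<..<0} \<Longrightarrow> 1 + 1 / \<gamma> \<in> {..<0}"
    "\<gamma> < -1 \<Longrightarrow> 1 + 1 / \<gamma> \<in> {0<..<1}"
    by (simp_all add: field_simps)
  have c_simps: "\<gamma> + 1 - 1 = \<gamma>" "1 - (\<gamma> + 1) = - \<gamma>"
    by simp_all
  note pos_eqs = SUP_U_set_eq[OF _ exponent(1)] SUP_U_beta_eq INF_renyi_bound_eq renyi_bound_attained_pos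
  have neg_fin: "\<gamma> < 0" "\<gamma> < -1 \<or> (AE x in P. \<tau> x < \<infinity>) \<and> W < \<infinity>"
    if "\<gamma> \<in> {-1<..<0} \<and> (AE x in P. \<tau> x < \<infinity>) \<and> W < \<infinity> \<or> \<gamma> < -1"
    using that by auto
  show ?thesis
    unfolding Let_def c_simps
  \<comment> \<open>The instantiated conjunction rules split only the outer conjunction, so each
    chain of equalities stays one goal.\<close>
  proof (intro conjI[of "\<forall>I \<beta>. _ I \<beta>"] conjI[of "_ \<longrightarrow> _"] impI, goal_cases)
    case 1
    show ?case using Q\<gamma>_in_U_set U_set_subset_U_beta by blast
  next
    case 2
    then show ?case by (simp only: pos_eqs simp_thms)
  next
    case 3
    note fin = neg_fin[OF disjI1[OF 3]]
    show ?case
      using 3 by (simp only: INF_U_set_eq[OF fin exponent(2)] INF_U_beta_eq[OF fin]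
        SUP_renyi_bound_eq[OF fin] renyi_bound_attained_neg[OF fin] simp_thms)
  next
    case 4
    note fin = neg_fin[OF disjI2[OF 4]]
    show ?case
      using 4 by (simp only: INF_U_set_eq[OF fin exponent(3)] INF_U_beta_eq[OF fin]
        SUP_renyi_bound_eq[OF fin] renyi_bound_attained_neg[OF fin] simp_thms)
  qed
qed

end
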